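(* Fix $x\in\mathcal X$ and $b\in(0,1]$. For each $N\ge1$ let $\widehat y_N^{\mathrm{BoN}}(x)$ be the output of constrained Best-of-$N$ on $N$ i.i.d. candidates from $\pi_{\mathrm{ref}}(\cdot\mid x)$. If there exists a sequence $t_N\in\mathbb R$ such that $$N\,\widehat\Psi_A(t_N;x,b)\to 0\quad\text{and}\quad N\,\widehat\Psi_B(t_N;x,b)\to\infty\qquad (N\to\infty),$$ then $$\lim_{N\to\infty}\mathbb P\left[\widehat y_N^{\mathrm{BoN}}(x)\in B(x,b)\right]=1.$$
   Context: Setting. $\mathcal X$ is a set of prompts and $\mathcal Y$ is a finite or countable set of outputs. $\pi_{\mathrm{ref}}(\cdot\mid x)$ is a probability distribution on $\mathcal Y$ for each $x$ (reference policy). There are a true binary safety function $g^\star:\mathcal X\times\mathcal Y\to\{0,1\}$ (an output $y$ is truly safe if $g^\star(x,y)=1$), a learned reward proxy $\widehat r:\mathcal X\times\mathcal Y\to\mathbb R$, and a learned safety proxy $\widehat g:\mathcal X\times\mathcal Y\to[0,1]$. For $b\in(0,1]$ the proxy-feasible set is $\widehat{\mathcal S}_+(x,b)=\{y\in\mathcal Y:\widehat g(x,y)\ge b\}$. Put $A(x,b)=\{y\in\widehat{\mathcal S}_+(x,b): g^\star(x,y)=1\}$ and $B(x,b)=\{y\in\widehat{\mathcal S}_+(x,b): g^\star(x,y)=0\}$. For $\lozenge\in\{A,B\}$ and $t\in\mathbb R$, the learned-score tail is $\widehat\Psi_\lozenge(t;x,b)=\mathbb P_{y\sim\pi_{\mathrm{ref}}(\cdot\mid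 x)}[y\in\lozenge(x,b),\ \widehat r(x,y)>t]$. Constrained Best-of-$N$: given candidates $y_1,\ldots,y_N$, let $\mathcal I_N(x,b)=\{i\in\{1,\dots,N\}: y_i\in\widehat{\mathcal S}_+(x,b)\}$. If $\mathcal I_N(x,b)\ne\varnothing$, it returns $\widehat y_N^{\mathrm{BoN}}(x)=y_{i^*}$ for some $i^*\in\arg\max_{i\in\mathcal I_N(x,b)}\widehat r(x,y_i)$, ties being broken arbitrarily. If $\mathcal I_N(x,b)=\varnothing$ it abstains, and abstention does not count as the event $\widehat y_N^{\mathrm{BoN}}(x)\in B(x,b)$. *)

theory Defs
  imports "HOL-Probability.Probability"
begin

definition proxy_feasible :: "('x \<Rightarrow> 'y \<Rightarrow> real) \<Rightarrow> 'x \<Rightarrow> real \<Rightarrow> 'y set" where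
  "proxy_feasible ghat x b = {y. ghat x y \<ge> b}"

definition feasible_safe ::
  "('x \<Rightarrow> 'y \<Rightarrow> nat) \<Rightarrow> ('x \<Rightarrow> 'y \<Rightarrow> real) \<Rightarrow> 'x \<Rightarrow> real \<Rightarrow> 'y set" where
  "feasible_safe gstar ghat x b = {y \<in> proxy_feasible ghat x b. gstar x y = 1}"

definition feasible_unsafe ::
  "('x \<Rightarrow> 'y \<Rightarrow> nat) \<Rightarrow> ('x \<Rightarrow> 'y \<Rightarrow> real) \<Rightarrow> 'x \<Rightarrow> real \<Rightarrow> 'y set" where
  "feasible_unsafe gstar ghat x b = {y \<in> proxy_feasible ghat x b. gstar x y = 0}"

definition learned_tail ::
  "('x \<Rightarrow> 'y pmf) \<Rightarrow> ('x \<Rightarrow> 'y \<Rightarrow> real) \<Rightarrow> ('x \<Rightarrow> real \<Rightarrow> 'y set) \<Rightarrow> real \<Rightarrow> 'x \<Rightarrow> real \<Rightarrow> real"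
  where
  "learned_tail piref rhat D t x b =
     measure_pmf.prob (piref x) {y. y \<in> D x b \<and> rhat x y > t}"

definition feasible_indices ::
  "('x \<Rightarrow> 'y \<Rightarrow> real) \<Rightarrow> 'x \<Rightarrow> real \<Rightarrow> nat \<Rightarrow> (nat \<Rightarrow> 'y) \<Rightarrow> nat set" where
  "feasible_indices ghat x b N ys = {i \<in> {1..N}. ys i \<in> proxy_feasible ghat x b}"

text \<open>
  A relation rather than a function, so that ties may be broken in any way (possibly at random,
  and differently for different \<^term>\<open>N\<close>); \<^term>\<open>None\<close> is abstention.
\<close>
definition BoN_output ::
  "('x \<Rightarrow> 'y \<Rightarrow> real) \<Rightarrow> ('x \<Rightarrow> 'y \<Rightarrow> real) \<Rightarrow> 'x \<Rightarrow> real \<Rightarrow> nat \<Rightarrow> (nat \<Rightarrow> 'y) \<Rightarrow> 'y option \<Rightarrow> bool"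
  where
  "BoN_output rhat ghat x b N ys out \<longleftrightarrow>
     (if feasible_indices ghat x b N ys = {} then out = None
      else \<exists>i. is_arg_max (\<lambda>i. rhat x (ys i)) (\<lambda>i. i \<in> feasible_indices ghat x b N ys) i
               \<and> out = Some (ys i))"

definition iid_candidates :: "'w measure \<Rightarrow> 'y pmf \<Rightarrow> nat \<Rightarrow> (nat \<Rightarrow> 'w \<Rightarrow> 'y) \<Rightarrow> bool" where
  "iid_candidates M p N Y \<longleftrightarrow>
     prob_space.indep_vars M (\<lambda>_. count_space UNIV) Y {1..N} \<and>
     (\<forall>i\<in>{1..N}. distr M (count_space UNIV) (Y i) = measure_pmf p)"

end

theory Submission
  imports Defs
begin

text \<open>
  If no safe feasible candidate scores above the threshold t but some unsafe feasible one does,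
  then every maximiser of the learned score is unsafe. By the union bound the first event fails
  with probability at most N Psi_A(t); by independence the second one fails with probability
  (1 - Psi_B(t))^N \<le> exp(- N Psi_B(t)).
\<close>

lemma iid_candidates_measurable:
  assumes "prob_space M" "iid_candidates M p N Y" "i \<in> {1..N}"
  shows "Y i \<in> measurable M (count_space UNIV)"
  using assms unfolding iid_candidates_def by (auto simp: prob_space.indep_vars_def)

lemma iid_candidates_prob:
  assumes "prob_space M" "iid_candidates M p N Y" "i \<in> {1..N}"
  shows "measure M (Y i -` T \<inter> space M) = measure_pmf.prob p T"
proof -
  have "measure_pmf.prob p T = measure (distr M (count_space UNIV) (Y i)) T"
    using assms unfolding iid_candidates_def by simp
  also have "\<dots> = measure M (Y i -` T \<inter> space M)"
    by (rule measure_distr[OF iid_candidates_measurable[OF assms]]) simp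
  finally show ?thesis by simp
qed

lemma iid_candidates_prob_some_le:
  assumes "prob_space M" "iid_candidates M p N Y"
  shows "measure M (\<Union>i\<in>{1..N}. Y i -` T \<inter> space M) \<le> real N * measure_pmf.prob p T"
proof -
  interpret prob_space M by fact
  have "prob (\<Union>i\<in>{1..N}. Y i -` T \<inter> space M) \<le> (\<Sum>i\<in>{1..N}. prob (Y i -` T \<inter> space M))"
    using iid_candidates_measurable[OF assms]
    by (intro finite_measure_subadditive_finite) (auto intro: measurable_sets)
  also have "\<dots> = real N * measure_pmf.prob p T"
    using iid_candidates_prob[OF assms] by simp
  finally show ?thesis .
qed

lemma iid_candidates_prob_none_le:
  assumes "prob_space M" "iid_candidates M p N Y" "N \<ge> 1"
  shows "measure M (\<Inter>i\<in>{1..N}. Y i -` (- T) \<inter> space M) \<le> exp (- (real N * measure_pmf.prob p T))"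
proof -
  interpret prob_space M by fact
  have compl: "measure_pmf.prob p (- T) = 1 - measure_pmf.prob p T"
    by (simp add: measure_pmf.prob_compl[of T p, simplified] Compl_eq_Diff_UNIV)
  \<comment> \<open>Here \<open>N \<ge> 1\<close> matters: the product rule wants a nonempty index
    set, and an empty intersection would be \<open>UNIV\<close> instead of
    \<open>space M\<close>.\<close>
  have "prob (\<Inter>i\<in>{1..N}. Y i -` (- T) \<inter> space M) = (\<Prod>i\<in>{1..N}. prob (Y i -` (- T) \<inter> space M))"
    using assms(2,3) unfolding iid_candidates_def by (intro indep_varsD) auto
  also have "\<dots> = (1 - measure_pmf.prob p T) ^ N"
    using iid_candidates_prob[OF assms(1,2)] by (simp add: compl)
  \<comment> \<open>This is \<open>1 - q \<le> exp (- q)\<close> raised to the power N, the base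
    \<open>1 - q\<close> being nonnegative because q is a probability. In the exponential form N and
    q enter only through their product, the quantity that the theorem sends to infinity.\<close>
  also have "\<dots> \<le> exp (- measure_pmf.prob p T) ^ N"
    using exp_ge_add_one_self[of "- measure_pmf.prob p T"] by (intro power_mono) auto
  also have "\<dots> = exp (- (real N * measure_pmf.prob p T))"
    by (simp flip: exp_of_nat_mult)
  finally show ?thesis .
qed

text \<open>Deterministic part, for one fixed sample and any way of breaking ties. Candidate j is
  itself feasible, so a returned maximiser scores at least as much as j and hence more than t. No
  safe feasible candidate does, and binary labels leave only the unsafe case.\<close>

lemma BoN_output_unsafe:
  assumes binary: "\<And>y. gstar x y \<in> {0, 1}"
    and out: "BoN_output rhat ghat x b N ys out"
    and safe: "\<And>i. i \<in> {1..N} \<Longrightarrow> ys i \<in> feasible_safe gstar ghat x b \<Longrightarrow> rhat x (ys i) \<le> t"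
    and unsafe: "j \<in> {1..N}" "ys j \<in> feasible_unsafe gstar ghat x b" "rhat x (ys j) > t"
  shows "out \<in> Some ` feasible_unsafe gstar ghat x b"
proof -
  \<comment> \<open>Feasibility of j also rules out abstention.\<close>
  have j: "j \<in> feasible_indices ghat x b N ys"
    using unsafe by (auto simp: feasible_indices_def feasible_unsafe_def)
  then obtain i where i: "i \<in> feasible_indices ghat x b N ys" "out = Some (ys i)"
      and "\<not> rhat x (ys j) > rhat x (ys i)"
    using out by (auto simp: BoN_output_def is_arg_max_def split: if_splits)
  with unsafe(3) have "rhat x (ys i) > t" by simp
  then have "ys i \<notin> feasible_safe gstar ghat x b"
    using safe[of i] i(1) by (force simp: feasible_indices_def)
  then show ?thesis
    using i binary[of "ys i"]
    by (auto simp: feasible_indices_def feasible_safe_def feasible_unsafe_def)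
qed

text \<open>A bound for each single N and an arbitrary threshold t, so that the theorem may choose
  t, and even the probability space, anew for every N.\<close>

lemma prob_BoN_unsafe_ge:
  fixes yhat :: "'w \<Rightarrow> 'y option"
  assumes binary: "\<And>y. gstar x y \<in> {0, 1}"
    and M: "prob_space M" and N: "N \<ge> 1"
    and iid: "iid_candidates M (piref x) N Y"
    and meas: "yhat \<in> measurable M (count_space UNIV)"
    and out: "\<And>\<omega>. \<omega> \<in> space M \<Longrightarrow> BoN_output rhat ghat x b N (\<lambda>i. Y i \<omega>) (yhat \<omega>)"
  shows "measure M {\<omega> \<in> space M. yhat \<omega> \<in> Some ` feasible_unsafe gstar ghat x b} \<ge>
     1 - real N * learned_tail piref rhat (feasible_safe gstar ghat) t x b
       - exp (- (real N * learned_tail piref rhat (feasible_unsafe gstar ghat) t x b))"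
proof -
  interpret prob_space M by fact
  define TA where "TA = {y. y \<in> feasible_safe gstar ghat x b \<and> rhat x y > t}"
  define TB where "TB = {y. y \<in> feasible_unsafe gstar ghat x b \<and> rhat x y > t}"
  define G where "G = {\<omega> \<in> space M. yhat \<omega> \<in> Some ` feasible_unsafe gstar ghat x b}"
  \<comment> \<open>The two ways to fail: in F some safe feasible candidate scores above t, in H no
    unsafe feasible one does.\<close>
  define F where "F = (\<Union>i\<in>{1..N}. Y i -` TA \<inter> space M)"
  define H where "H = (\<Inter>i\<in>{1..N}. Y i -` (- TB) \<inter> space M)"
  \<comment> \<open>As a preimage, G is an event by measurability of \<open>yhat\<close>, which has
    to be assumed because arbitrary tie-breaking could be non-measurable.\<close>
  have "G = yhat -` (Some ` feasible_unsafe gstar ghat x b) \<inter> space M"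
    by (auto simp: G_def)
  then have G: "G \<in> events"
    using measurable_sets[OF meas] by simp
  have Y: "Y i -` T \<inter> space M \<in> events" if "i \<in> {1..N}" for i T
    using measurable_sets[OF iid_candidates_measurable[OF M iid that]] by simp
  have F: "F \<in> events"
    unfolding F_def by (intro sets.finite_UN Y) simp_all
  have H: "H \<in> events"
    unfolding H_def using N by (intro sets.finite_INT Y) simp_all
  have "space M - G \<subseteq> F \<union> H"
  proof
    fix \<omega> assume \<omega>: "\<omega> \<in> space M - G"
    show "\<omega> \<in> F \<union> H"
    proof (rule ccontr)
      assume "\<omega> \<notin> F \<union> H"
      \<comment> \<open>Being outside H supplies a high-scoring unsafe j, and being outside F bounds
        every safe feasible score by t: the premises of \<open>BoN_output_unsafe\<close>.\<close>
      with \<omega> obtain j where "j \<in> {1..N}" "Y j \<omega> \<in> TB" and "\<And>i. i \<in> {1..N} \<Longrightarrow> Y i \<omega> \<notin> TA"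
        using N by (auto simp: F_def H_def)
      with \<omega> have "yhat \<omega> \<in> Some ` feasible_unsafe gstar ghat x b"
        using BoN_output_unsafe[of gstar x rhat ghat b N "\<lambda>i. Y i \<omega>" "yhat \<omega>" t j, OF binary out]
        by (force simp: TA_def TB_def)
      with \<omega> show False by (simp add: G_def)
    qed
  qed
  then have "1 - prob G \<le> prob (F \<union> H)"
    using F H G by (simp add: finite_measure_mono flip: prob_compl)
  also have "\<dots> \<le> prob F + prob H"
    using F H by (rule measure_Un_le)
  also have "\<dots> \<le> real N * measure_pmf.prob (piref x) TA + exp (- (real N * measure_pmf.prob (piref x) TB))"
    unfolding F_def H_def
    by (intro add_mono iid_candidates_prob_some_le iid_candidates_prob_none_le M iid N)
  finally show ?thesis
    by (simp add: G_def TA_def TB_def learned_tail_def)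
qed

theorem theorem4p2:
  fixes piref :: "'x \<Rightarrow> 'y::countable pmf"
    and gstar :: "'x \<Rightarrow> 'y \<Rightarrow> nat"
    and rhat ghat :: "'x \<Rightarrow> 'y \<Rightarrow> real"
    and x :: 'x and b :: real
    and M :: "nat \<Rightarrow> 'w measure"
    and Y :: "nat \<Rightarrow> nat \<Rightarrow> 'w \<Rightarrow> 'y"
    and yhat :: "nat \<Rightarrow> 'w \<Rightarrow> 'y option"
  assumes "\<And>x y. gstar x y \<in> {0, 1}"
    and "\<And>x y. ghat x y \<in> {0..1}"
    and "b \<in> {0<..1}"
    and "\<And>N. N \<ge> 1 \<Longrightarrow> prob_space (M N)"
    and "\<And>N. N \<ge> 1 \<Longrightarrow> iid_candidates (M N) (piref x) N (Y N)"
    and "\<And>N. N \<ge> 1 \<Longrightarrow> yhat N \<in> measurable (M N) (count_space UNIV)"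
    and "\<And>N \<omega>. N \<ge> 1 \<Longrightarrow> \<omega> \<in> space (M N) \<Longrightarrow>
           BoN_output rhat ghat x b N (\<lambda>i. Y N i \<omega>) (yhat N \<omega>)"
    and "\<exists>t :: nat \<Rightarrow> real.
           (\<lambda>N. real N * learned_tail piref rhat (feasible_safe gstar ghat) (t N) x b)
             \<longlonglongrightarrow> 0 \<and>
           filterlim
             (\<lambda>N. real N * learned_tail piref rhat (feasible_unsafe gstar ghat) (t N) x b)
             at_top sequentially"
  shows "(\<lambda>N. measure (M N) {\<omega> \<in> space (M N).
            yhat N \<omega> \<in> Some ` feasible_unsafe gstar ghat x b}) \<longlonglongrightarrow> 1"
proof -
  obtain t :: "nat \<Rightarrow> real" where
    A: "(\<lambda>N. real N * learned_tail piref rhat (feasible_safe gstar ghat) (t N) x b) \<longlonglongrightarrow> 0"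
       (is "?A \<longlonglongrightarrow> 0") and
    B: "filterlim (\<lambda>N. real N * learned_tail piref rhat (feasible_unsafe gstar ghat) (t N) x b)
          at_top sequentially" (is "filterlim ?B at_top sequentially")
    using assms(8) by blast
  let ?P = "\<lambda>N. measure (M N) {\<omega> \<in> space (M N). yhat N \<omega> \<in> Some ` feasible_unsafe gstar ghat x b}"
  have "(\<lambda>N. exp (- ?B N)) \<longlonglongrightarrow> 0"
    using B by (intro filterlim_compose[OF exp_at_bot] filterlim_compose[OF filterlim_uminus_at_bot_at_top])
  then have lower: "(\<lambda>N. 1 - ?A N - exp (- ?B N)) \<longlonglongrightarrow> 1"
    using tendsto_diff[OF tendsto_diff[OF tendsto_const A]] by fastforce
  \<comment> \<open>The lower bound is available from N = 1 on, where the hypotheses on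
    \<open>M N\<close>, \<open>Y N\<close> and \<open>yhat N\<close> start; this suffices for the
    limit. The upper bound only says that a probability is at most 1.\<close>
  show ?thesis
  proof (rule tendsto_sandwich[OF _ _ lower tendsto_const])
    show "\<forall>\<^sub>F N in sequentially. 1 - ?A N - exp (- ?B N) \<le> ?P N"
      using eventually_ge_at_top[of 1]
    proof eventually_elim
      case (elim N)
      show ?case
        using elim assms(1) by (intro prob_BoN_unsafe_ge[where Y = "Y N"] assms(4-7))
    qed
    show "\<forall>\<^sub>F N in sequentially. ?P N \<le> 1"
      using eventually_ge_at_top[of 1]
      by eventually_elim (rule prob_space.prob_le_1[OF assms(4)])
  qed
qed

end
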